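(* Let $X$ be a real Banach space, $H$ a real Hilbert space (identified with its dual), $K\subseteq H$ a nonempty closed convex set, $F:X\to X^*$ continuously differentiable and $g:X\to H$ twice continuously differentiable. Assume that $(\bar{x},\bar{\lambda})\in X\times H$ is a KKT point which satisfies the second-order sufficient condition (SOSC) and the strict Robinson condition (SRC). Then $\mathcal{M}(\bar{x})=\{\bar{\lambda}\}$ and there are $c>0$ and $\delta>0$ such that, for all $(x,\lambda)\in X\times H$ with $\|x-\bar{x}\|_X<\delta$ and $\sigma(x,\lambda)<\delta$, $$\|x-\bar{x}\|_X+\|\lambda-\bar{\lambda}\|_H\le c\,\sigma(x,\lambda).$$
   Context: Derivatives are Fréchet derivatives; $g'(x)^*:H\to X^*$ is the adjoint of $g'(x)$; $D_x$ is the derivative with respect to $x$. $P_K$ is the metric projection onto $K$. For $y\in K$, $\mathcal{N}_K(y)=\{\psi\in H:(\psi,z-y)\le 0\ \forall z\in K\}$ is the normal cone and $\mathcal{T}_K(y)=\{d\in H:\exists\, y^k\to y,\ t_k\downarrow 0,\ y^k\in K,\ (y^k-y)/t_k\to d\}$ the tangent cone; both are empty if $y\notin K$. The Lagrange function is $\mathcal{L}:X\times H\to X^*$, $\mathcal{L}(x,\lambda):=F(x)+g'(x)^*\lambda$. A pair $(\bar{x},\bar{\lambda})\in X\times H$ is a KKT point if $\mathcal{L}(\bar{x},\bar{\lambda})=0$ and $\bar{\lambda}\in\mathcal{N}_K(g(\bar{x}))$. The multiplier set is $\mathcal{M}(\bar{x}):=\{\lambda\in H:(\bar{x},\lambda)\text{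 is a KKT point}\}$. The residual mapping is $\sigma(x,\lambda):=\|\mathcal{L}(x,\lambda)\|_{X^*}+\|g(x)-P_K(g(x)+\lambda)\|_H$. SOSC at $(\bar{x},\bar{\lambda})$: for $\eta\ge 0$ let $C_\eta(\bar{x}):=\{d\in X:\langle F(\bar{x}),d\rangle\le\eta\|d\|_X,\ g'(\bar{x})d\in\mathcal{T}_K(g(\bar{x}))\}$. SOSC holds if there are $\eta,c>0$ such that $\langle D_x\mathcal{L}(\bar{x},\bar{\lambda})d,d\rangle\ge c\|d\|_X^2$ for all $d\in C_\eta(\bar{x})$. SRC at $(\bar{x},\bar{\lambda})$: with $K_0:=\{y\in K:(\bar{\lambda},y-g(\bar{x}))=0\}$, one has $0\in\operatorname{int}\bigl(g(\bar{x})+g'(\bar{x})X-K_0\bigr)$. *)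

theory Defs
  imports "HOL-Analysis.Analysis"
begin

text \<open>The dual space of a Banach space \<open>'a\<close> is the type of bounded linear functionals
  \<open>'a \<Rightarrow>\<^sub>L real\<close> with the operator norm. A real Hilbert space is a type of sort
  \<open>{real_inner, banach}\<close>.\<close>

text \<open>The library constant \<^const>\<open>frechet_derivative\<close> yields a plain function; we bundle it as a
  bounded linear operator, so that \<open>x \<mapsto> f'(x)\<close> is a map into a normed space.
  It is meaningful only at points where \<open>f\<close> is differentiable.\<close>

definition fderiv :: "('a::real_normed_vector \<Rightarrow> 'b::real_normed_vector) \<Rightarrow> 'a \<Rightarrow> ('a \<Rightarrow>\<^sub>L 'b)"
  where "fderiv f x = Blinfun (frechet_derivative f (at x))"

lemma fderiv_works:
  assumes "f differentiable (at x)"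
  shows "(f has_derivative blinfun_apply (fderiv f x)) (at x)"
proof -
  have d: "(f has_derivative frechet_derivative f (at x)) (at x)"
    using assms frechet_derivative_works by blast
  then have "bounded_linear (frechet_derivative f (at x))"
    by (rule has_derivative_bounded_linear)
  with d show ?thesis
    by (simp add: fderiv_def bounded_linear_Blinfun_apply)
qed

definition continuously_differentiable ::
    "('a::real_normed_vector \<Rightarrow> 'b::real_normed_vector) \<Rightarrow> bool"
  where "continuously_differentiable f \<longleftrightarrow>
    (\<forall>x. f differentiable (at x)) \<and> continuous_on UNIV (fderiv f)"

definition twice_continuously_differentiable ::
    "('a::real_normed_vector \<Rightarrow> 'b::real_normed_vector) \<Rightarrow> bool"
  where "twice_continuously_differentiable f \<longleftrightarrow>
    (\<forall>x. f differentiable (at x)) \<and> continuously_differentiable (fderiv f)"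

text \<open>The adjoint \<open>T\<^sup>* : H \<rightarrow> X\<^sup>*\<close>, where \<open>H\<close> is identified with its dual:
  \<open>\<langle>T\<^sup>* l, d\<rangle> = (l, T d)\<close>. The library's \<^const>\<open>adjoint\<close> needs an inner product on both spaces.\<close>

definition dual_adjoint ::
    "('a::real_normed_vector \<Rightarrow>\<^sub>L 'h::real_inner) \<Rightarrow> 'h \<Rightarrow> ('a \<Rightarrow>\<^sub>L real)"
  where "dual_adjoint T l = blinfun_inner_left l o\<^sub>L T"

text \<open>The library's \<^const>\<open>closest_point\<close> is restricted to Heine-Borel (that is, finite-dimensional)
  spaces; this is the same definition without that restriction.\<close>

definition metric_projection :: "'h::real_inner set \<Rightarrow> 'h \<Rightarrow> 'h"
  where "metric_projection K y = (SOME z. z \<in> K \<and> (\<forall>w\<in>K. dist y z \<le> dist y w))"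

definition normal_cone :: "'h::real_inner set \<Rightarrow> 'h \<Rightarrow> 'h set"
  where "normal_cone K y = {p. y \<in> K \<and> (\<forall>z\<in>K. p \<bullet> (z - y) \<le> 0)}"

definition tangent_cone :: "'h::real_normed_vector set \<Rightarrow> 'h \<Rightarrow> 'h set"
  where "tangent_cone K y = {d. y \<in> K \<and>
    (\<exists>(u :: nat \<Rightarrow> 'h) (t :: nat \<Rightarrow> real). (\<forall>k. u k \<in> K) \<and> (\<forall>k. t k > 0) \<and>
      u \<longlonglongrightarrow> y \<and> t \<longlonglongrightarrow> 0 \<and> (\<lambda>k. (u k - y) /\<^sub>R t k) \<longlonglongrightarrow> d)}"

definition lagrange ::
    "('a::real_normed_vector \<Rightarrow> ('a \<Rightarrow>\<^sub>L real)) \<Rightarrow> ('a \<Rightarrow> 'h::real_inner) \<Rightarrow> 'a \<Rightarrow> 'h \<Rightarrow> ('a \<Rightarrow>\<^sub>L real)"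
  where "lagrange F g x l = F x + dual_adjoint (fderiv g x) l"

definition KKT_point ::
    "('a::real_normed_vector \<Rightarrow> ('a \<Rightarrow>\<^sub>L real)) \<Rightarrow> ('a \<Rightarrow> 'h::real_inner) \<Rightarrow> 'h set \<Rightarrow> 'a \<Rightarrow> 'h \<Rightarrow> bool"
  where "KKT_point F g K x l \<longleftrightarrow> lagrange F g x l = 0 \<and> l \<in> normal_cone K (g x)"

definition multiplier_set ::
    "('a::real_normed_vector \<Rightarrow> ('a \<Rightarrow>\<^sub>L real)) \<Rightarrow> ('a \<Rightarrow> 'h::real_inner) \<Rightarrow> 'h set \<Rightarrow> 'a \<Rightarrow> 'h set"
  where "multiplier_set F g K x = {l. KKT_point F g K x l}"

definition residual ::
    "('a::real_normed_vector \<Rightarrow> ('a \<Rightarrow>\<^sub>L real)) \<Rightarrow> ('a \<Rightarrow> 'h::real_inner) \<Rightarrow> 'h set \<Rightarrow> 'a \<Rightarrow> 'h \<Rightarrow> real"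
  where "residual F g K x l =
    norm (lagrange F g x l) + norm (g x - metric_projection K (g x + l))"

definition critical_cone ::
    "('a::real_normed_vector \<Rightarrow> ('a \<Rightarrow>\<^sub>L real)) \<Rightarrow> ('a \<Rightarrow> 'h::real_inner) \<Rightarrow> 'h set \<Rightarrow> real \<Rightarrow> 'a \<Rightarrow> 'a set"
  where "critical_cone F g K \<eta> x =
    {d. F x d \<le> \<eta> * norm d \<and> fderiv g x d \<in> tangent_cone K (g x)}"

definition SOSC ::
    "('a::real_normed_vector \<Rightarrow> ('a \<Rightarrow>\<^sub>L real)) \<Rightarrow> ('a \<Rightarrow> 'h::real_inner) \<Rightarrow> 'h set \<Rightarrow> 'a \<Rightarrow> 'h \<Rightarrow> bool"
  where "SOSC F g K x l \<longleftrightarrow>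
    (\<exists>\<eta>>0. \<exists>c>0. \<forall>d \<in> critical_cone F g K \<eta> x.
      fderiv (\<lambda>z. lagrange F g z l) x d d \<ge> c * (norm d)\<^sup>2)"

definition strict_Robinson ::
    "('a::real_normed_vector \<Rightarrow> 'h::real_inner) \<Rightarrow> 'h set \<Rightarrow> 'a \<Rightarrow> 'h \<Rightarrow> bool"
  where "strict_Robinson g K x l \<longleftrightarrow>
    0 \<in> interior {g x + fderiv g x d - y | d y. y \<in> K \<and> l \<bullet> (y - g x) = 0}"

end

theory Submission
  imports Defs
begin

text \<open>
  Write \<open>G = g'(xbar)\<close>, let \<open>y\<close> be the projection of \<open>g x + l\<close> onto \<open>K\<close> and put \<open>\<mu> = l + g x - y\<close>. Then \<open>\<mu>\<close>
  is normal to \<open>K\<close> at \<open>y\<close>, and \<open>\<mu> - l = g x - y\<close> is bounded by the residual \<open>s\<close>. So it is enough to bound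
  \<open>\<mu> - lbar\<close> and \<open>x - xbar\<close> by \<open>s\<close>.
  The first bound rests on the strict Robinson condition, the second mainly on the second-order condition.

  Multipliers. By Baire's theorem the strict Robinson condition makes a ball of radius \<open>r\<close> lie in the
  closure of the vectors \<open>G d + g xbar - z\<close> with \<open>\<parallel>d\<parallel> \<le> 1\<close>, \<open>z \<in> K\<close> and
  \<open>lbar \<bullet> (z - g xbar) = 0\<close> (\<open>strict_Robinson_imp_cball\<close>). Tested against these vectors, \<open>\<mu> - lbar\<close> is
  controlled by its image under the adjoint of \<open>G\<close>, up to a product that is negligible near the
  solution (\<open>multiplier_difference_bound\<close>). This yields both the uniqueness of \<open>lbar\<close> and
  \<open>\<parallel>\<mu> - lbar\<parallel> \<le> C (\<parallel>x - xbar\<parallel> + s)\<close> (\<open>multiplier_error_bound\<close>).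

  Primal variable. Suppose \<open>s\<close> were much smaller than \<open>\<parallel>x - xbar\<parallel>\<close>. Then \<open>v = x - xbar\<close> is almost a
  critical direction: \<open>G v\<close> is close to \<open>y - g xbar\<close>, which is tangent to \<open>K\<close>, and \<open>F(xbar) v\<close> is almost
  nonpositive because \<open>\<mu>\<close> is normal at \<open>y\<close> and close to \<open>lbar\<close>. The space may be infinite-dimensional, so no limit
  of normalised directions is available. Instead, \<open>v\<close> is moved into the enlarged critical cone by a small
  correction, whose existence is again a consequence of the strict Robinson condition
  (\<open>tangent_correction\<close>, \<open>nearby_critical_direction\<close>). The second-order condition now bounds the
  curvature of the Lagrangian along \<open>v\<close> below, while the smallness of the residual and the monotonicity
  of the normal cone bound it above by a small multiple of \<open>\<parallel>v\<parallel>\<^sup>2\<close> (\<open>curvature_upper_bound\<close>). This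
  contradiction gives \<open>\<parallel>x - xbar\<parallel> \<le> M s\<close> (\<open>primal_error_bound\<close>).
\<close>

section \<open>Projections in Hilbert space\<close>

text \<open>The points of \<open>K\<close> whose squared distance to \<open>p\<close> exceeds the smallest possible value by at most
  \<open>1/(n+1)\<close> form nested closed sets. By the parallelogram identity and the convexity of \<open>K\<close> their
  diameters tend to zero, so completeness yields a common point. This argument replaces local compactness.\<close>

lemma nearest_point_exists:
  fixes K :: "'h::{real_inner, banach} set"
  assumes "K \<noteq> {}" "closed K" "convex K"
  shows "\<exists>z\<in>K. \<forall>w\<in>K. dist p z \<le> dist p w"
proof -
  define D where "D = infdist p K"
  define S where "S n = K \<inter> cball p (sqrt (D\<^sup>2 + 1 / real (Suc n)))" for n
  have D0: "0 \<le> D" by (simp add: D_def infdist_nonneg)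
  have Dle: "D \<le> dist p w" if "w \<in> K" for w
    using that by (simp add: D_def infdist_le)
  have ne: "S n \<noteq> {}" for n
  proof -
    have "D < sqrt (D\<^sup>2 + 1 / real (Suc n))"
      using D0 by (intro real_less_rsqrt) auto
    then have "(INF w\<in>K. dist p w) < sqrt (D\<^sup>2 + 1 / real (Suc n))"
      using assms(1) by (simp add: D_def infdist_def)
    then obtain w where "w \<in> K" "dist p w < sqrt (D\<^sup>2 + 1 / real (Suc n))"
      using cInf_lessD[of "dist p ` K"] assms(1) by auto
    then show ?thesis by (auto simp: S_def)
  qed
  have anti: "S n \<subseteq> S m" if "m \<le> n" for m n
  proof -
    have "sqrt (D\<^sup>2 + 1 / real (Suc n)) \<le> sqrt (D\<^sup>2 + 1 / real (Suc m))"
      using that by (simp add: frac_le)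
    then show ?thesis unfolding S_def by (intro Int_mono subset_refl) (rule subset_cball)
  qed
  have close: "(dist u v)\<^sup>2 \<le> 4 / real (Suc n)" if "u \<in> S n" "v \<in> S n" for u v n
  proof -
    have uv: "u \<in> K" "v \<in> K" using that by (auto simp: S_def)
    have sq: "(norm (p - w))\<^sup>2 \<le> D\<^sup>2 + 1 / real (Suc n)" if "w \<in> S n" for w
    proof -
      have "norm (p - w) \<le> sqrt (D\<^sup>2 + 1 / real (Suc n))"
        using that by (simp add: S_def dist_norm)
      then have "(norm (p - w))\<^sup>2 \<le> (sqrt (D\<^sup>2 + 1 / real (Suc n)))\<^sup>2"
        by (intro power_mono) auto
      then show ?thesis by (simp add: add_nonneg_nonneg)
    qed
    have "(1/2) *\<^sub>R u + (1/2) *\<^sub>R v \<in> K"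
      using assms(3) uv by (rule convexD) auto
    from Dle[OF this] have "D\<^sup>2 \<le> (norm (p - ((1/2) *\<^sub>R u + (1/2) *\<^sub>R v)))\<^sup>2"
      using D0 by (intro power_mono) (auto simp: dist_norm)
    moreover have "(dist u v)\<^sup>2 = 2 * (norm (p - u))\<^sup>2 + 2 * (norm (p - v))\<^sup>2
        - 4 * (norm (p - ((1/2) *\<^sub>R u + (1/2) *\<^sub>R v)))\<^sup>2"
      by (simp add: dist_norm power2_norm_eq_inner algebra_simps inner_commute)
    ultimately show ?thesis using sq[OF that(1)] sq[OF that(2)] by simp
  qed
  have small: "\<exists>n. \<forall>x\<in>S n. \<forall>y\<in>S n. dist x y < e" if "e > 0" for e
  proof -
    obtain n where n: "4 / e\<^sup>2 < real n" using reals_Archimedean2 by blast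
    have e2: "0 < e\<^sup>2" using that by simp
    have "4 < real n * e\<^sup>2" using n e2 by (simp add: pos_divide_less_eq)
    also have "\<dots> \<le> real (Suc n) * e\<^sup>2" using e2 by (intro mult_right_mono) auto
    finally have n': "4 / real (Suc n) < e\<^sup>2"
      by (simp add: pos_divide_less_eq mult.commute)
    have "dist x y < e" if "x \<in> S n" "y \<in> S n" for x y
      using close[OF that] n' \<open>e > 0\<close> by (intro power2_less_imp_less[of _ e]) auto
    then show ?thesis by blast
  qed
  have clS: "closed (S n)" for n
    unfolding S_def using assms(2) by (intro closed_Int closed_cball)
  obtain z where z: "\<And>n. z \<in> S n"
    by (rule decreasing_closed_nest[of S, OF clS ne anti small]) blast+
  have "dist p z \<le> D"
  proof (rule power2_le_imp_le[OF _ D0])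
    have "(dist p z)\<^sup>2 \<le> D\<^sup>2 + 1 / real (Suc n)" for n
    proof -
      have "dist p z \<le> sqrt (D\<^sup>2 + 1 / real (Suc n))"
        using z[of n] by (simp add: S_def)
      then have "(dist p z)\<^sup>2 \<le> (sqrt (D\<^sup>2 + 1 / real (Suc n)))\<^sup>2"
        by (intro power_mono) auto
      then show ?thesis by (simp add: add_nonneg_nonneg)
    qed
    moreover have "(\<lambda>n. D\<^sup>2 + 1 / real (Suc n)) \<longlonglongrightarrow> D\<^sup>2 + 0"
      by (intro tendsto_intros LIMSEQ_Suc lim_1_over_n)
    ultimately show "(dist p z)\<^sup>2 \<le> D\<^sup>2"
      by (metis (no_types, lifting) LIMSEQ_le_const add.right_neutral)
  qed
  moreover have "z \<in> K" using z[of 0] by (simp add: S_def)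
  ultimately show ?thesis using Dle by force
qed

lemma metric_projection_normal:
  fixes K :: "'h::{real_inner, banach} set"
  assumes "K \<noteq> {}" "closed K" "convex K"
  shows "p - metric_projection K p \<in> normal_cone K (metric_projection K p)"
proof -
  have "metric_projection K p \<in> K \<and> (\<forall>w\<in>K. dist p (metric_projection K p) \<le> dist p w)"
    unfolding metric_projection_def
    by (rule someI_ex) (use nearest_point_exists[OF assms] in blast)
  then show ?thesis
    using any_closest_point_dot[OF assms(3,2)] by (auto simp: normal_cone_def)
qed

section \<open>The strict Robinson condition as a uniform bound\<close>

text \<open>The integer multiples of the closure of \<open>A\<close> cover the space, so by Baire's theorem one of
  them contains a ball, say around \<open>w\<close>. Since \<open>A\<close> also absorbs \<open>- w\<close>, a convex combination of this
  ball with a multiple of \<open>- w\<close> is a ball around the origin.\<close>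

lemma absorbing_convex_closure_nhd:
  fixes A :: "'h::banach set"
  assumes "convex A" and absorb: "\<And>h. \<exists>t>0. t *\<^sub>R h \<in> A"
  shows "\<exists>r>0. cball 0 r \<subseteq> closure A"
proof -
  define B where "B n = {x. (1 / real (Suc n)) *\<^sub>R x \<in> closure A}" for n
  have zA: "0 \<in> A" using absorb[of 0] by auto
  have clB: "closed (B n)" for n
  proof -
    have "B n = (\<lambda>x. (1 / real (Suc n)) *\<^sub>R x) -` closure A" by (auto simp: B_def)
    then show ?thesis by (auto intro!: closed_vimage continuous_intros)
  qed
  have "h \<in> \<Union>(range B)" for h
  proof -
    obtain t where t: "t > 0" "t *\<^sub>R h \<in> A" using absorb by blast
    obtain n where n: "1 / t < real n" using reals_Archimedean2 by blast
    define s where "s = 1 / (real (Suc n) * t)"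
    have s: "0 \<le> s" "s \<le> 1"
      using t n by (auto simp: s_def field_simps)
    have "(1 - s) *\<^sub>R 0 + s *\<^sub>R (t *\<^sub>R h) \<in> A"
      using assms(1) zA t(2) by (rule convexD) (use s in auto)
    moreover have "s *\<^sub>R (t *\<^sub>R h) = (1 / real (Suc n)) *\<^sub>R h"
      using t by (simp add: s_def)
    ultimately have "(1 / real (Suc n)) *\<^sub>R h \<in> A"
      by (simp only: scaleR_zero_right add_0)
    then have "h \<in> B n" unfolding B_def using closure_subset by blast
    then show ?thesis by blast
  qed
  then have cover: "\<Union>(range B) = UNIV" by blast
  have "\<exists>n. interior (B n) \<noteq> {}"
  proof (rule ccontr)
    assume "\<not> ?thesis"
    then have "interior (\<Union>(range B)) = {}"
      using Met_TC.metric_Baire_category_alt[of "range B"] clB complete_UNIV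
      by (auto simp: mcomplete_iff_complete)
    with cover show False by simp
  qed
  then obtain n w \<rho> where w: "\<rho> > 0" "ball w \<rho> \<subseteq> B n"
    by (meson ex_in_conv mem_interior)
  define k where "k = real (Suc n)"
  have k: "k > 0" by (simp add: k_def)
  have w': "u \<in> closure A" if "norm (k *\<^sub>R u - w) < \<rho>" for u
  proof -
    have "k *\<^sub>R u \<in> B n" using that w(2) by (auto simp: dist_norm norm_minus_commute)
    then show ?thesis using k by (simp add: B_def k_def)
  qed
  obtain s where s: "s > 0" "s *\<^sub>R (- w) \<in> A" using absorb by blast
  \<comment> \<open>With this weight on the centre \<open>w / k\<close> of the ball and the remaining weight on \<open>- s w\<close> the
    convex combination is zero.\<close>
  define \<theta> where "\<theta> = k * s / (1 + k * s)"
  have ks: "k * s > 0" using k s by simp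
  have \<theta>: "0 < \<theta>" "\<theta> < 1" using ks by (auto simp: \<theta>_def field_simps)
  have q: "\<theta> * \<rho> / k > 0" using \<theta> w k by simp
  have half: "a / 2 < a" if "a > 0" for a :: real using that by simp
  have "ball 0 (\<theta> * \<rho> / k) \<subseteq> closure A"
  proof
    fix v :: 'h assume "v \<in> ball 0 (\<theta> * \<rho> / k)"
    then have v: "norm v < \<theta> * \<rho> / k" by simp
    define u where "u = (1 / k) *\<^sub>R w + (1 / \<theta>) *\<^sub>R v"
    have "k *\<^sub>R u - w = (k / \<theta>) *\<^sub>R v" using k by (simp add: u_def algebra_simps)
    then have "norm (k *\<^sub>R u - w) < \<rho>"
      using v k \<theta> by (simp add: field_simps)
    then have "u \<in> closure A" by (rule w')
    moreover have "s *\<^sub>R (- w) \<in> closure A" using s closure_subset by blast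
    ultimately have "\<theta> *\<^sub>R u + (1 - \<theta>) *\<^sub>R (s *\<^sub>R (- w)) \<in> closure A"
      using convex_closure[OF assms(1)] \<theta> by (intro convexD) auto
    moreover have "\<theta> *\<^sub>R u + (1 - \<theta>) *\<^sub>R (s *\<^sub>R (- w)) = v"
    proof -
      have "\<theta> / k = (1 - \<theta>) * s"
      proof -
        have "1 - \<theta> = 1 / (1 + k * s)" using ks by (simp add: \<theta>_def field_simps)
        then show ?thesis using k by (simp add: \<theta>_def)
      qed
      then have "(\<theta> / k) *\<^sub>R w = ((1 - \<theta>) * s) *\<^sub>R w" by simp
      then show ?thesis using \<theta> by (simp add: u_def scaleR_add_right)
    qed
    ultimately show "v \<in> closure A" by simp
  qed
  moreover have "cball 0 (\<theta> * \<rho> / k / 2) \<subseteq> ball (0::'h) (\<theta> * \<rho> / k)"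
  proof
    fix x :: 'h assume "x \<in> cball 0 (\<theta> * \<rho> / k / 2)"
    then have "norm x \<le> \<theta> * \<rho> / k / 2" by simp
    also have "\<dots> < \<theta> * \<rho> / k" using q by (rule half)
    finally show "x \<in> ball 0 (\<theta> * \<rho> / k)" by simp
  qed
  ultimately show ?thesis using half_gt_zero[OF q] by (meson subset_trans)
qed

text \<open>With the bound on \<open>d\<close> the linear functional \<open>a \<mapsto> m \<bullet> a\<close> can be estimated below on this set through
  the adjoint of \<open>G\<close>. The point \<open>z\<close> ranges freely, since its contribution to such estimates is
  controlled by its sign.\<close>

definition robinson_set :: "('a::real_normed_vector \<Rightarrow>\<^sub>L 'h::real_inner) \<Rightarrow> 'h set \<Rightarrow> 'h \<Rightarrow> 'h \<Rightarrow> 'h set"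
  where "robinson_set G K y l =
    {G d + y - z | d z. norm d \<le> 1 \<and> z \<in> K \<and> l \<bullet> (z - y) = 0}"

text \<open>By the strict Robinson condition small multiples of each vector are of the form \<open>G d + y - z\<close>.
  Shrinking \<open>d\<close> to the unit ball, and \<open>z\<close> towards \<open>y = g x\<close> by the same factor, shows that the set is
  absorbing. Its closure suffices everywhere below, because it is only used to bound continuous
  functionals and to start a successive approximation.\<close>

lemma strict_Robinson_imp_cball:
  fixes g :: "'a::real_normed_vector \<Rightarrow> 'h::{real_inner, banach}"
  assumes "convex K" "g x \<in> K" "strict_Robinson g K x l"
  shows "\<exists>r>0. cball 0 r \<subseteq> closure (robinson_set (fderiv g x) K (g x) l)"
proof (rule absorbing_convex_closure_nhd)
  let ?G = "fderiv g x"
  show "convex (robinson_set ?G K (g x) l)"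
  proof (rule convexI)
    fix a b :: 'h and u v :: real
    assume uv: "0 \<le> u" "0 \<le> v" "u + v = 1"
    assume "a \<in> robinson_set ?G K (g x) l" "b \<in> robinson_set ?G K (g x) l"
    then obtain d z d' z' where
      a: "a = ?G d + g x - z" "norm d \<le> 1" "z \<in> K" "l \<bullet> (z - g x) = 0" and
      b: "b = ?G d' + g x - z'" "norm d' \<le> 1" "z' \<in> K" "l \<bullet> (z' - g x) = 0"
      by (auto simp: robinson_set_def)
    have v: "v = 1 - u" using uv by simp
    show "u *\<^sub>R a + v *\<^sub>R b \<in> robinson_set ?G K (g x) l"
      unfolding robinson_set_def mem_Collect_eq
    proof (intro exI conjI)
      show "u *\<^sub>R a + v *\<^sub>R b = ?G (u *\<^sub>R d + v *\<^sub>R d') + g x - (u *\<^sub>R z + v *\<^sub>R z')"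
        unfolding a b v by (simp add: blinfun.bilinear_simps algebra_simps)
      have "norm (u *\<^sub>R d + v *\<^sub>R d') \<le> u * norm d + v * norm d'"
        using uv by (metis abs_of_nonneg norm_scaleR norm_triangle_ineq)
      also have "\<dots> \<le> 1" using a b uv by (simp add: convex_bound_le)
      finally show "norm (u *\<^sub>R d + v *\<^sub>R d') \<le> 1" .
      show "u *\<^sub>R z + v *\<^sub>R z' \<in> K" using assms(1) a(3) b(3) uv by (rule convexD)
      have "l \<bullet> (u *\<^sub>R z + v *\<^sub>R z' - g x) = u * (l \<bullet> (z - g x)) + v * (l \<bullet> (z' - g x))"
        unfolding v by (simp add: inner_simps algebra_simps)
      then show "l \<bullet> (u *\<^sub>R z + v *\<^sub>R z' - g x) = 0" using a b by simp
    qed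
  qed
next
  fix h :: 'h
  let ?G = "fderiv g x"
  obtain e where e: "e > 0"
    "ball 0 e \<subseteq> {g x + fderiv g x d - y | d y. y \<in> K \<and> l \<bullet> (y - g x) = 0}"
    using assms(3) unfolding strict_Robinson_def mem_interior by blast
  have N: "norm h + 1 > 0" using norm_ge_zero[of h] by linarith
  define s where "s = e / 2 / (norm h + 1)"
  have s: "s > 0" unfolding s_def using e(1) N by (intro divide_pos_pos) auto
  have "norm (s *\<^sub>R h) < e"
  proof -
    have "norm (s *\<^sub>R h) = s * norm h" using s by simp
    also have "\<dots> \<le> s * (norm h + 1)" using s by simp
    also have "\<dots> = e / 2" using nonzero_eq_divide_eq[of "norm h + 1" s "e / 2"] N s_def by simp
    also have "\<dots> < e" using e by simp
    finally show ?thesis .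
  qed
  then have "s *\<^sub>R h \<in> ball 0 e" by simp
  then obtain d z where dz: "s *\<^sub>R h = g x + ?G d - z" "z \<in> K" "l \<bullet> (z - g x) = 0"
    using e(2) by blast
  define \<tau> where "\<tau> = 1 / (1 + norm d)"
  have \<tau>: "0 < \<tau>" "\<tau> \<le> 1" by (auto simp: \<tau>_def field_simps add_pos_nonneg)
  have "\<tau> *\<^sub>R (s *\<^sub>R h) \<in> robinson_set ?G K (g x) l"
    unfolding robinson_set_def mem_Collect_eq
  proof (intro exI conjI)
    show "\<tau> *\<^sub>R (s *\<^sub>R h) = ?G (\<tau> *\<^sub>R d) + g x - ((1 - \<tau>) *\<^sub>R g x + \<tau> *\<^sub>R z)"
      unfolding dz(1) by (simp add: blinfun.bilinear_simps algebra_simps)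
    show "norm (\<tau> *\<^sub>R d) \<le> 1" by (simp add: \<tau>_def field_simps add_pos_nonneg)
    show "(1 - \<tau>) *\<^sub>R g x + \<tau> *\<^sub>R z \<in> K"
      using assms(1,2) dz(2) by (rule convexD) (use \<tau> in auto)
    have "l \<bullet> ((1 - \<tau>) *\<^sub>R g x + \<tau> *\<^sub>R z - g x) = \<tau> * (l \<bullet> (z - g x))"
      by (simp add: inner_simps algebra_simps)
    then show "l \<bullet> ((1 - \<tau>) *\<^sub>R g x + \<tau> *\<^sub>R z - g x) = 0" using dz by simp
  qed
  then show "\<exists>t>0. t *\<^sub>R h \<in> robinson_set ?G K (g x) l"
    using s \<tau> by (intro exI[of _ "\<tau> * s"]) auto
qed

text \<open>For \<open>a = G d + y0 - z\<close> in the Robinson set, the orthogonality of \<open>l0\<close> to \<open>z - y0\<close> and the normality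
  of \<open>m\<close> at \<open>y\<close> and of \<open>l0\<close> at \<open>y0\<close> bound \<open>(m - l0) \<bullet> a\<close> below by the negative of the right-hand side.
  Testing with the vector of length \<open>r\<close> opposite to \<open>m - l0\<close> gives the claim. For \<open>y = y0\<close> this is the
  uniqueness of the multiplier; for \<open>y\<close> near \<open>y0\<close> the last term can be absorbed into the left-hand
  side.\<close>

lemma multiplier_difference_bound:
  fixes G :: "'a::real_normed_vector \<Rightarrow>\<^sub>L 'h::real_inner"
  assumes r: "r > 0" "cball 0 r \<subseteq> closure (robinson_set G K y0 l0)"
    and l0: "l0 \<in> normal_cone K y0" and m: "m \<in> normal_cone K y"
  shows "r * norm (m - l0) \<le> norm (dual_adjoint G (m - l0)) + norm (m - l0) * norm (y - y0)"
proof -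
  let ?M = "norm (dual_adjoint G (m - l0)) + norm (m - l0) * norm (y - y0)"
  have lower: "- ?M \<le> (m - l0) \<bullet> a" if "a \<in> robinson_set G K y0 l0" for a
  proof -
    obtain d z where a: "a = G d + y0 - z" "norm d \<le> 1" "z \<in> K" "l0 \<bullet> (z - y0) = 0"
      using \<open>a \<in> _\<close> by (auto simp: robinson_set_def)
    have "\<bar>dual_adjoint G (m - l0) d\<bar> \<le> norm (dual_adjoint G (m - l0)) * norm d"
      by (metis norm_blinfun real_norm_def)
    also have "\<dots> \<le> norm (dual_adjoint G (m - l0))" using a(2) by (simp add: mult_left_le)
    finally have 1: "\<bar>G d \<bullet> (m - l0)\<bar> \<le> norm (dual_adjoint G (m - l0))"
      by (simp add: dual_adjoint_def)
    have 2: "m \<bullet> (z - y) \<le> 0" using m a(3) by (simp add: normal_cone_def)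
    have 3: "l0 \<bullet> (y - y0) \<le> 0" using l0 m by (simp add: normal_cone_def)
    have 4: "\<bar>(m - l0) \<bullet> (y - y0)\<bar> \<le> norm (m - l0) * norm (y - y0)"
      by (rule Cauchy_Schwarz_ineq2)
    \<comment> \<open>Apart from the first and third term, which are estimated in norm, every summand
      contributes nonnegatively or vanishes.\<close>
    have "(m - l0) \<bullet> a = G d \<bullet> (m - l0) - m \<bullet> (z - y) - (m - l0) \<bullet> (y - y0)
        - l0 \<bullet> (y - y0) + l0 \<bullet> (z - y0)"
      unfolding a(1) by (simp add: algebra_simps inner_commute)
    then show ?thesis using 1 2 3 4 a(4) by linarith
  qed
  have "closed {a. - ?M \<le> (m - l0) \<bullet> a}"
    by (intro closed_Collect_le continuous_intros)
  then have cl: "closure (robinson_set G K y0 l0) \<subseteq> {a. - ?M \<le> (m - l0) \<bullet> a}"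
    using lower by (intro closure_minimal) auto
  show ?thesis
  proof (cases "m = l0")
    case False
    define h where "h = - (r / norm (m - l0)) *\<^sub>R (m - l0)"
    have "h \<in> cball 0 r" using r False by (simp add: h_def)
    then have "- ?M \<le> (m - l0) \<bullet> h" using r cl by blast
    also have "(m - l0) \<bullet> h = - r * norm (m - l0)"
      using False by (simp add: h_def power2_norm_eq_inner[symmetric] power2_eq_square)
    finally show ?thesis by simp
  qed simp
qed

section \<open>Tangent directions and their correction\<close>

definition radial_cone :: "'h::real_vector set \<Rightarrow> 'h \<Rightarrow> 'h set"
  where "radial_cone K y = convex_cone hull ((\<lambda>z. z - y) ` K)"

lemma radial_cone_cases:
  assumes "convex K" "y \<in> K" "d \<in> radial_cone K y"
  obtains s z where "s \<ge> 0" "z \<in> K" "d = s *\<^sub>R (z - y)"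
proof -
  have "convex ((\<lambda>z. z - y) ` K)" using assms(1) by (rule convex_translation_subtract)
  then have "radial_cone K y = (\<Union>x \<in> (\<lambda>z. z - y) ` K. \<Union>c\<in>{0..}. {c *\<^sub>R x})"
    unfolding radial_cone_def using assms(2)
    by (subst convex_cone_hull_convex_hull_nonempty) (auto simp: hull_same)
  then show ?thesis using assms(3) that by auto
qed

text \<open>If \<open>s (z - y)\<close> approximates \<open>d\<close>, then by convexity \<open>y + t s (z - y)\<close> stays in \<open>K\<close> as long as
  \<open>t s \<le> 1\<close>. Step sizes proportional to \<open>1 / (1 + s)\<close> respect this bound and can be sent to zero, no
  matter how fast \<open>s\<close> grows along the approximating sequence.\<close>

lemma closure_radial_cone_subset_tangent_cone:
  fixes K :: "'h::real_normed_vector set"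
  assumes "convex K" "y \<in> K"
  shows "closure (radial_cone K y) \<subseteq> tangent_cone K y"
proof
  fix d assume "d \<in> closure (radial_cone K y)"
  then obtain f where f: "\<And>n. f n \<in> radial_cone K y" "f \<longlonglongrightarrow> d"
    unfolding closure_sequential by blast
  have "\<exists>s z. s \<ge> 0 \<and> z \<in> K \<and> f n = s *\<^sub>R (z - y)" for n
    using radial_cone_cases[OF assms f(1)] by metis
  then obtain s z where sz: "\<And>n. s n \<ge> 0" "\<And>n. z n \<in> K" "\<And>n. f n = s n *\<^sub>R (z n - y)"
    by metis
  define t where "t n = 1 / real (Suc n) * (1 / (1 + s n))" for n
  have t0: "t n > 0" for n using sz(1)[of n] by (simp add: t_def)
  have ts1: "t n * s n \<le> 1" for n
  proof -
    have "s n / (1 + s n) \<le> 1" using sz(1)[of n] by simp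
    moreover have "0 \<le> s n / (1 + s n)" using sz(1)[of n] by simp
    ultimately have "1 / real (Suc n) * (s n / (1 + s n)) \<le> 1 * 1"
      by (intro mult_mono) auto
    then show ?thesis by (simp add: t_def)
  qed
  have tle: "t n \<le> 1 / real (Suc n)" for n
  proof -
    have "1 / real (Suc n) * (1 / (1 + s n)) \<le> 1 / real (Suc n) * 1"
      using sz(1)[of n] by (intro mult_left_mono) auto
    then show ?thesis by (simp add: t_def)
  qed
  have tlim: "t \<longlonglongrightarrow> 0"
    by (rule tendsto_sandwich[OF _ _ tendsto_const LIMSEQ_Suc[OF lim_1_over_n]])
      (use t0 tle in \<open>auto intro!: always_eventually less_imp_le\<close>)
  define u where "u n = y + t n *\<^sub>R f n" for n
  have "u n \<in> K" for n
  proof -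
    have "(1 - t n * s n) *\<^sub>R y + (t n * s n) *\<^sub>R z n \<in> K"
      using assms sz(2) by (intro convexD) (use ts1[of n] t0[of n] sz(1)[of n] in auto)
    then show ?thesis by (simp add: u_def sz(3) algebra_simps)
  qed
  moreover have "u \<longlonglongrightarrow> y + 0 *\<^sub>R d" unfolding u_def by (intro tendsto_intros tlim f(2))
  moreover have "(\<lambda>n. (u n - y) /\<^sub>R t n) = f"
    using t0 by (auto simp: u_def fun_eq_iff less_imp_neq[THEN not_sym])
  ultimately show "d \<in> tangent_cone K y"
    using assms(2) t0 tlim f(2) unfolding tangent_cone_def by auto
qed

lemma convex_cone_closure_radial_cone:
  fixes K :: "'h::real_normed_vector set"
  shows "convex_cone (closure (radial_cone K y))"
proof -
  have "convex_cone (radial_cone K y)" by (simp add: radial_cone_def convex_cone_convex_cone_hull)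
  then have c: "convex (closure (radial_cone K y))" "conic (radial_cone K y)" "radial_cone K y \<noteq> {}"
    by (auto simp: convex_cone_def)
  have "conic (closure (radial_cone K y))"
    using cone_closure[of "radial_cone K y"] c(2) by (simp add: Convex.cone_def conic_def)
  then show ?thesis using c by (auto simp: convex_cone_def)
qed

text \<open>If \<open>G d - \<tau>\<close> can approximate every \<open>h\<close> up to half of its norm, then iterating on the remainders gives a
  geometric series for \<open>d\<close>. Its partial sums converge because the domain is complete. The
  corresponding sums of elements of \<open>T\<close> are determined by the partial sums, \<open>h\<close> and the remainder, so
  they converge too, and their limit is in \<open>T\<close> as \<open>T\<close> is a closed convex cone. This is the step of the open mapping theorem from approximate to exact
  solvability.\<close>

lemma solve_inclusion_by_successive_approximation:
  fixes G :: "'a::banach \<Rightarrow>\<^sub>L 'h::real_normed_vector"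
  assumes T: "convex_cone T" "closed T"
    and approx: "\<And>h. \<exists>d. \<exists>\<tau>\<in>T. norm d \<le> C * norm h \<and> norm (h - (G d - \<tau>)) \<le> norm h / 2"
  shows "\<exists>d. norm d \<le> 2 * C * norm h \<and> G d - h \<in> T"
proof -
  obtain D \<tau> where D: "\<And>h. norm (D h) \<le> C * norm h" "\<And>h. \<tau> h \<in> T"
      "\<And>h. norm (h - (G (D h) - \<tau> h)) \<le> norm h / 2"
    using approx by metis
  define R where "R k = ((\<lambda>h. h - (G (D h) - \<tau> h)) ^^ k) h" for k
  have R0: "R 0 = h" by (simp add: R_def)
  have RS: "R (Suc k) = R k - (G (D (R k)) - \<tau> (R k))" for k by (simp add: R_def)
  have Rn: "norm (R k) \<le> norm h * (1/2)^k" for k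
  proof (induction k)
    case (Suc k)
    have "norm (R (Suc k)) \<le> norm (R k) / 2" using D(3) by (simp add: RS)
    then show ?case using Suc by simp
  qed (simp add: R0)
  show ?thesis
  proof (cases "h = 0")
    case True
    then show ?thesis using T by (intro exI[of _ 0]) (auto simp: convex_cone_contains_0 blinfun.zero_right)
  next
    case False
    \<comment> \<open>A negative \<open>C\<close> is excluded by the hypothesis applied to a nonzero vector.\<close>
    then have C0: "C \<ge> 0" using D(1)[of h] norm_ge_zero[of "D h"]
      by (smt (verit) mult_neg_pos zero_less_norm_iff)
    have Dn: "norm (D (R k)) \<le> C * norm h * (1/2)^k" for k
      using D(1)[of "R k"] mult_left_mono[OF Rn C0, of k] by (simp add: mult.assoc)
    have geo: "(\<lambda>k. C * norm h * (1/2)^k) sums (C * norm h * 2)"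
      using sums_mult[OF geometric_sums[of "1/2::real"], of "C * norm h"] by simp
    have sn: "summable (\<lambda>k. norm (D (R k)))"
      by (rule summable_comparison_test'[OF sums_summable[OF geo]]) (use Dn in auto)
    then have sD: "summable (\<lambda>k. D (R k))" by (rule summable_norm_cancel)
    define d where "d = (\<Sum>k. D (R k))"
    have "norm d \<le> (\<Sum>k. norm (D (R k)))" unfolding d_def by (rule summable_norm[OF sn])
    also have "\<dots> \<le> (\<Sum>k. C * norm h * (1/2)^k)"
      by (rule suminf_le[OF Dn sn sums_summable[OF geo]])
    also have "\<dots> = 2 * C * norm h" using sums_unique[OF geo] by simp
    finally have nd: "norm d \<le> 2 * C * norm h" .
    have tel: "(\<Sum>k<n. \<tau> (R k)) = G (\<Sum>k<n. D (R k)) - h + R n" for n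
    proof (induction n)
      case (Suc n)
      then show ?case by (simp add: RS blinfun.bilinear_simps)
    qed (simp add: R0 blinfun.zero_right)
    have inT: "(\<Sum>k<n. \<tau> (R k)) \<in> T" for n
      by (induction n) (auto simp: D(2) convex_cone_add[OF T(1)] convex_cone_contains_0[OF T(1)])
    have R_lim: "R \<longlonglongrightarrow> 0"
    proof (rule Lim_null_comparison)
      show "\<forall>\<^sub>F n in sequentially. norm (R n) \<le> norm h * (1/2)^n" using Rn by simp
      have "(\<lambda>n. norm h * (1/2)^n) \<longlonglongrightarrow> norm h * 0"
        by (intro tendsto_intros LIMSEQ_realpow_zero) auto
      then show "(\<lambda>n. norm h * (1/2)^n) \<longlonglongrightarrow> 0" by simp
    qed
    have "(\<lambda>n. \<Sum>k<n. D (R k)) \<longlonglongrightarrow> d"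
      using summable_LIMSEQ[OF sD] by (simp add: d_def)
    then have "(\<lambda>n. \<Sum>k<n. \<tau> (R k)) \<longlonglongrightarrow> G d - h + 0"
      unfolding tel by (intro tendsto_intros R_lim)
    then have "G d - h \<in> T"
      using closed_sequentially[OF T(2), of "\<lambda>n. \<Sum>k<n. \<tau> (R k)"] inT by simp
    with nd show ?thesis by blast
  qed
qed

text \<open>A direction whose image under \<open>G\<close> misses the tangent cone by \<open>h\<close> is repaired by adding a vector \<open>d\<close> of
  size proportional to \<open>h\<close>. Points of \<open>K\<close> in the Robinson set enter only through the cone spanned by
  \<open>K - y\<close>.\<close>

lemma tangent_correction:
  fixes G :: "'a::banach \<Rightarrow>\<^sub>L 'h::real_inner"
  assumes "convex K" "y \<in> K"
    and r: "r > 0" "cball 0 r \<subseteq> closure (robinson_set G K y l)"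
  shows "\<exists>d. norm d \<le> 2 / r * norm h \<and> G d - h \<in> closure (radial_cone K y)"
proof -
  let ?T = "closure (radial_cone K y)"
  have "\<exists>d. \<exists>\<tau>\<in>?T. norm d \<le> 1 / r * norm h \<and> norm (h - (G d - \<tau>)) \<le> norm h / 2" for h
  proof (cases "h = 0")
    case True
    then show ?thesis
      using convex_cone_contains_0[OF convex_cone_closure_radial_cone, of K y]
      by (intro exI[of _ 0] bexI[of _ 0]) (auto simp: blinfun.zero_right)
  next
    case False
    define s where "s = norm h / r"
    have s: "s > 0" using False r by (simp add: s_def)
    have "(1 / s) *\<^sub>R h \<in> cball 0 r" using False r by (simp add: s_def)
    then obtain a where a: "a \<in> robinson_set G K y l" "dist a ((1 / s) *\<^sub>R h) < r / 2"
      using r closure_approachable by (metis half_gt_zero subsetD)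
    then obtain d z where dz: "a = G d + y - z" "norm d \<le> 1" "z \<in> K"
      by (auto simp: robinson_set_def)
    have "s *\<^sub>R (z - y) \<in> radial_cone K y"
      unfolding radial_cone_def using dz(3) s
      by (intro convex_cone_hull_mul hull_inc) auto
    then have 1: "s *\<^sub>R (z - y) \<in> ?T" using closure_subset by blast
    have "h - (G (s *\<^sub>R d) - s *\<^sub>R (z - y)) = s *\<^sub>R ((1 / s) *\<^sub>R h - a)"
      using s by (simp add: dz(1) blinfun.bilinear_simps algebra_simps)
    then have "norm (h - (G (s *\<^sub>R d) - s *\<^sub>R (z - y))) = s * dist a ((1 / s) *\<^sub>R h)"
      using s by (simp add: dist_norm norm_minus_commute)
    also have "\<dots> \<le> s * (r / 2)" using a(2) s by (intro mult_left_mono) auto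
    also have "\<dots> = norm h / 2" using r by (simp add: s_def)
    finally have 2: "norm (h - (G (s *\<^sub>R d) - s *\<^sub>R (z - y))) \<le> norm h / 2" .
    have "norm (s *\<^sub>R d) \<le> 1 / r * norm h"
      using mult_left_mono[OF dz(2), of s] s by (simp add: s_def[symmetric])
    with 1 2 show ?thesis by blast
  qed
  from solve_inclusion_by_successive_approximation[OF convex_cone_closure_radial_cone _ this]
  show ?thesis by simp
qed

section \<open>Calculus of the Lagrangian\<close>

lemma dual_adjoint_apply [simp]: "dual_adjoint T l d = T d \<bullet> l"
  by (simp add: dual_adjoint_def)

lemma dual_adjoint_add: "dual_adjoint T (k + l) = dual_adjoint T k + dual_adjoint T l"
  by (rule blinfun_eqI) (simp add: blinfun.bilinear_simps inner_simps)

lemma dual_adjoint_diff: "dual_adjoint T (k - l) = dual_adjoint T k - dual_adjoint T l"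
  by (rule blinfun_eqI) (simp add: blinfun.bilinear_simps inner_simps)

lemma dual_adjoint_diff_left: "dual_adjoint (S - T) l = dual_adjoint S l - dual_adjoint T l"
  by (rule blinfun_eqI) (simp add: blinfun.bilinear_simps inner_simps)

lemma norm_dual_adjoint_le: "norm (dual_adjoint T l) \<le> norm T * norm l"
proof (rule norm_blinfun_bound)
  fix d
  have "\<bar>T d \<bullet> l\<bar> \<le> norm (T d) * norm l" by (rule Cauchy_Schwarz_ineq2)
  also have "\<dots> \<le> (norm T * norm d) * norm l" by (intro mult_right_mono norm_blinfun) auto
  finally show "norm (dual_adjoint T l d) \<le> norm T * norm l * norm d" by (simp add: ac_simps)
qed simp

lemma lagrange_differentiable:
  assumes "F differentiable (at x)" "fderiv g differentiable (at x)"
  shows "(\<lambda>z. lagrange F g z l) differentiable (at x)"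
proof -
  have "bounded_linear (\<lambda>T. dual_adjoint T l)"
    unfolding dual_adjoint_def by (intro bounded_linear_intros)
  then have "((\<lambda>z. dual_adjoint (fderiv g z) l) has_derivative
      (\<lambda>d. dual_adjoint (fderiv (fderiv g) x d) l)) (at x)"
    using fderiv_works[OF assms(2)] by (rule bounded_linear.has_derivative)
  then have "(\<lambda>z. dual_adjoint (fderiv g z) l) differentiable (at x)"
    by (rule differentiableI)
  with assms(1) show ?thesis unfolding lagrange_def by (rule differentiable_add)
qed

lemma linearization_error:
  assumes "f differentiable (at x)" "e > 0"
  shows "\<exists>\<delta>>0. \<forall>y. norm (y - x) < \<delta> \<longrightarrow>
    norm (f y - f x - fderiv f x (y - x)) \<le> e * norm (y - x)"
  using fderiv_works[OF assms(1)] assms(2) unfolding has_derivative_at_alt by blast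

lemma differentiable_imp_pointwise_Lipschitz:
  assumes "f differentiable (at x)"
  shows "\<exists>L>0. \<exists>\<delta>>0. \<forall>y. norm (y - x) < \<delta> \<longrightarrow> norm (f y - f x) \<le> L * norm (y - x)"
proof -
  obtain \<delta> where \<delta>: "\<delta> > 0"
    "\<And>y. norm (y - x) < \<delta> \<Longrightarrow> norm (f y - f x - fderiv f x (y - x)) \<le> 1 * norm (y - x)"
    using linearization_error[OF assms zero_less_one] by blast
  have "norm (f y - f x) \<le> (1 + norm (fderiv f x)) * norm (y - x)" if "norm (y - x) < \<delta>" for y
    using \<delta>(2)[OF that] norm_blinfun[of "fderiv f x" "y - x"]
      norm_triangle_sub[of "f y - f x" "fderiv f x (y - x)"] by (simp add: algebra_simps)
  then show ?thesis using \<delta>(1)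
    by (intro exI[of _ "1 + norm (fderiv f x)"]) (auto simp: add_pos_nonneg)
qed

section \<open>The dual error bound\<close>

text \<open>Here \<open>y\<close> stands for the projection of \<open>g x + l\<close>, \<open>s\<close> for the residual, and
  \<open>\<mu> = l + g x - y\<close> is the shifted multiplier, which is normal to \<open>K\<close> at \<open>y\<close>.
  The functional \<open>g'(xbar)\<^sup>* (\<mu> - lbar)\<close> differs from \<open>lagrange F g x l\<close> only by terms of first order in \<open>x - xbar\<close> and in the residual. One of them is proportional to \<open>\<mu>\<close>
  itself; it and the product term of the previous bound carry small factors and are absorbed.\<close>

lemma multiplier_error_bound:
  fixes F :: "'a::real_normed_vector \<Rightarrow> ('a \<Rightarrow>\<^sub>L real)" and g :: "'a \<Rightarrow> 'h::real_inner"
  assumes r: "r > 0" "cball 0 r \<subseteq> closure (robinson_set (fderiv g xbar) K (g xbar) lbar)"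
    and KKT: "KKT_point F g K xbar lbar"
    and F: "F differentiable (at xbar)" and g: "g differentiable (at xbar)"
    and Dg: "fderiv g differentiable (at xbar)"
  shows "\<exists>C>0. \<exists>\<delta>>0. \<forall>x l y s. norm (x - xbar) < \<delta> \<longrightarrow> s < \<delta> \<longrightarrow>
    norm (lagrange F g x l) + norm (g x - y) = s \<longrightarrow> l + g x - y \<in> normal_cone K y \<longrightarrow>
    norm (l + g x - y - lbar) \<le> C * (norm (x - xbar) + s)"
proof -
  let ?G = "fderiv g xbar"
  obtain L1 \<delta>1 where F1: "L1 > 0" "\<delta>1 > 0"
    "\<And>x. norm (x - xbar) < \<delta>1 \<Longrightarrow> norm (F x - F xbar) \<le> L1 * norm (x - xbar)"
    using differentiable_imp_pointwise_Lipschitz[OF F] by blast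
  obtain L2 \<delta>2 where g1: "L2 > 0" "\<delta>2 > 0"
    "\<And>x. norm (x - xbar) < \<delta>2 \<Longrightarrow> norm (g x - g xbar) \<le> L2 * norm (x - xbar)"
    using differentiable_imp_pointwise_Lipschitz[OF g] by blast
  obtain L3 \<delta>3 where Dg1: "L3 > 0" "\<delta>3 > 0"
    "\<And>x. norm (x - xbar) < \<delta>3 \<Longrightarrow> norm (fderiv g x - ?G) \<le> L3 * norm (x - xbar)"
    using differentiable_imp_pointwise_Lipschitz[OF Dg] by blast
  define L where "L = max L1 (max L2 L3)"
  have L: "L > 0" "L1 \<le> L" "L2 \<le> L" "L3 \<le> L" using F1 by (auto simp: L_def)
  \<comment> \<open>The last radius makes \<open>L t + s\<close> at most \<open>r / 4\<close>, so that two terms of this size times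
    \<open>\<parallel>\<mu> - lbar\<parallel>\<close> use up only half of \<open>r \<parallel>\<mu> - lbar\<parallel>\<close>.\<close>
  define \<delta> where "\<delta> = min (min \<delta>1 \<delta>2) (min \<delta>3 (r / (4 * (L + 1))))"
  have \<delta>: "\<delta> > 0" "\<delta> \<le> \<delta>1" "\<delta> \<le> \<delta>2" "\<delta> \<le> \<delta>3" "\<delta> \<le> r / (4 * (L + 1))"
    using F1 g1 Dg1 r L by (auto simp: \<delta>_def)
  define C where "C = 2 / r * (1 + norm ?G + r / 4 + L * (1 + norm lbar))"
  have C: "C > 0" unfolding C_def using r L by (intro mult_pos_pos add_pos_nonneg) auto
  have lb: "lbar \<in> normal_cone K (g xbar)" "F xbar + dual_adjoint ?G lbar = 0"
    using KKT by (auto simp: KKT_point_def lagrange_def)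
  have "norm (l + g x - y - lbar) \<le> C * (norm (x - xbar) + s)"
    if x: "norm (x - xbar) < \<delta>" and s: "s < \<delta>"
      "norm (lagrange F g x l) + norm (g x - y) = s" and m: "l + g x - y \<in> normal_cone K y"
    for x l y s
  proof -
    define t where "t = norm (x - xbar)"
    define \<mu> where "\<mu> = l + g x - y"
    define n where "n = norm (\<mu> - lbar)"
    have n0: "n \<ge> 0" and t0: "t \<ge> 0" and s0: "s \<ge> 0"
      using s(2) by (auto simp: n_def t_def intro: add_nonneg_nonneg)
    have bF: "norm (F x - F xbar) \<le> L * t"
      using F1(3)[of x] x \<delta> mult_right_mono[OF L(2) t0] by (auto simp: t_def)
    have bg: "norm (g x - g xbar) \<le> L * t"
      using g1(3)[of x] x \<delta> mult_right_mono[OF L(3) t0] by (auto simp: t_def)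
    have bD: "norm (fderiv g x - ?G) \<le> L * t"
      using Dg1(3)[of x] x \<delta> mult_right_mono[OF L(4) t0] by (auto simp: t_def)
    have "(L + 1) * \<delta> \<le> r / 4"
      using \<delta>(5) L(1) by (simp add: field_simps)
    moreover have "L * t \<le> L * \<delta>" using x L by (simp add: t_def)
    ultimately have Lts: "L * t + s \<le> r / 4" using s(1) by (simp add: algebra_simps)
    have "norm (dual_adjoint ?G (\<mu> - lbar)) =
      norm (lagrange F g x l - (F x - F xbar) - dual_adjoint (fderiv g x - ?G) \<mu>
        + dual_adjoint (fderiv g x) (g x - y))"
    proof -
      have "dual_adjoint ?G (\<mu> - lbar) = lagrange F g x l - (F x - F xbar)
          - dual_adjoint (fderiv g x - ?G) \<mu> + dual_adjoint (fderiv g x) (g x - y)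
          - (F xbar + dual_adjoint ?G lbar)"
        by (simp add: \<mu>_def lagrange_def dual_adjoint_diff dual_adjoint_add dual_adjoint_diff_left)
      then show ?thesis using lb(2) by simp
    qed
    also have "\<dots> \<le> norm (lagrange F g x l) + norm (F x - F xbar)
        + norm (dual_adjoint (fderiv g x - ?G) \<mu>) + norm (dual_adjoint (fderiv g x) (g x - y))"
      by (intro norm_triangle_mono norm_triangle_le_diff order_refl)
        (auto intro!: norm_triangle_le_diff)
    also have "\<dots> \<le> s + L * t + L * t * (norm lbar + n) + (norm ?G + r / 4) * s"
    proof -
      have a: "norm (lagrange F g x l) \<le> s" "norm (g x - y) \<le> s"
        using s(2) norm_ge_zero[of "g x - y"] norm_ge_zero[of "lagrange F g x l"] by linarith+
      have "norm \<mu> \<le> norm lbar + n"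
        unfolding n_def by (rule norm_triangle_sub)
      then have "norm (fderiv g x - ?G) * norm \<mu> \<le> L * t * (norm lbar + n)"
        using bD L t0 by (intro mult_mono) auto
      then have b: "norm (dual_adjoint (fderiv g x - ?G) \<mu>) \<le> L * t * (norm lbar + n)"
        using norm_dual_adjoint_le order_trans by blast
      have "norm (fderiv g x) \<le> norm ?G + r / 4"
        using norm_triangle_sub[of "fderiv g x" ?G] bD Lts s0 by linarith
      then have "norm (fderiv g x) * norm (g x - y) \<le> (norm ?G + r / 4) * s"
        using a r by (intro mult_mono) auto
      then have c: "norm (dual_adjoint (fderiv g x) (g x - y)) \<le> (norm ?G + r / 4) * s"
        using norm_dual_adjoint_le order_trans by blast
      show ?thesis using a b c bF by linarith
    qed
    finally have adj: "norm (dual_adjoint ?G (\<mu> - lbar))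
      \<le> s + L * t + L * t * (norm lbar + n) + (norm ?G + r / 4) * s" .
    have yg: "norm (y - g xbar) \<le> L * t + s"
    proof -
      have "norm (y - g xbar) \<le> norm (g x - g xbar) + norm (g x - y)"
        using norm_triangle_ineq4[of "g x - g xbar" "g x - y"] by simp
      then show ?thesis using bg s(2) norm_ge_zero[of "lagrange F g x l"] by linarith
    qed
    have "r * n \<le> norm (dual_adjoint ?G (\<mu> - lbar)) + n * norm (y - g xbar)"
      unfolding n_def using m by (intro multiplier_difference_bound[OF r lb(1)]) (simp add: \<mu>_def)
    also have "\<dots> \<le> s + L * t + L * t * (norm lbar + n) + (norm ?G + r / 4) * s + n * (L * t + s)"
      using adj mult_left_mono[OF yg n0] by linarith
    also have "\<dots> \<le> s + L * t + L * t * norm lbar + (norm ?G + r / 4) * s + n * (r / 4) + n * (r / 4)"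
      using mult_left_mono[OF Lts n0] mult_nonneg_nonneg[OF n0 s0] by (simp add: algebra_simps)
    finally have "r * n / 2 \<le> (1 + norm ?G + r / 4) * s + L * (1 + norm lbar) * t"
      by (simp add: algebra_simps)
    also have "\<dots> \<le> (1 + norm ?G + r / 4 + L * (1 + norm lbar)) * (t + s)"
    proof -
      have "(p + q) * (t + s) = p * s + q * t + p * t + q * s" for p q :: real
        by (simp add: distrib_left distrib_right)
      moreover have "0 \<le> (1 + norm ?G + r / 4) * t" "0 \<le> L * (1 + norm lbar) * s"
        using r L t0 s0 by (auto intro!: mult_nonneg_nonneg add_nonneg_nonneg)
      ultimately show ?thesis by simp
    qed
    finally have "n \<le> C * (t + s)" using r by (simp add: C_def field_simps)
    then show ?thesis by (simp add: n_def \<mu>_def t_def)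
  qed
  then show ?thesis using C \<delta>(1) by blast
qed

section \<open>The primal error bound\<close>

text \<open>Suppose \<open>v\<close> solves the linearised inclusion up to a small relative error \<open>e\<close>, that is,
  \<open>G v\<close> nearly equals \<open>y - y0\<close> with \<open>y \<in> K\<close>. Since \<open>y - y0\<close> is tangent, a correction \<open>d\<close> of relative size
  \<open>e\<close> makes \<open>G (v + d)\<close> exactly tangent. The functional \<open>f = - G\<^sup>* l0\<close> is small along \<open>v\<close> because
  \<open>l0 \<bullet> (y - y0)\<close> is almost nonnegative: it differs by a quadratic quantity from \<open>m \<bullet> (y - y0)\<close>,
  which is nonnegative by the normality of \<open>m\<close>.\<close>

lemma nearby_critical_direction:
  fixes G :: "'a::banach \<Rightarrow>\<^sub>L 'h::real_inner" and f :: "'a \<Rightarrow>\<^sub>L real"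
  assumes K: "convex K" and r: "r > 0" "cball 0 r \<subseteq> closure (robinson_set G K y0 l0)"
    and l0: "l0 \<in> normal_cone K y0" "f + dual_adjoint G l0 = 0"
    and m: "m \<in> normal_cone K y"
    and e: "0 \<le> e" "e \<le> 1" "norm v \<le> e"
    and lin: "norm (y - y0 - G v) \<le> 2 * e * norm v"
    and mult: "norm (m - l0) \<le> C * norm v"
  shows "\<exists>d. norm d \<le> 4 / r * e * norm v \<and> G (v + d) \<in> tangent_cone K y0 \<and>
    f (v + d) \<le> (C * (norm G + 2) + 2 * norm l0 + norm f * (4 / r)) * e * norm v"
proof -
  let ?t = "norm v" and ?h = "y - y0 - G v" and ?T = "closure (radial_cone K y0)"
  have y0: "y0 \<in> K" and y: "y \<in> K" using l0 m by (auto simp: normal_cone_def)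
  obtain d where d: "norm d \<le> 2 / r * norm ?h" "G d - ?h \<in> ?T"
    using tangent_correction[OF K y0 r] by blast
  have "2 / r * norm ?h \<le> 2 / r * (2 * e * ?t)" using lin r by (intro mult_left_mono) auto
  with d(1) have nd: "norm d \<le> 4 / r * e * ?t" by simp
  have "y - y0 \<in> radial_cone K y0"
    unfolding radial_cone_def using y by (intro hull_inc) auto
  then have "(y - y0) + (G d - ?h) \<in> ?T"
    using closure_subset by (intro convex_cone_add[OF convex_cone_closure_radial_cone] d(2)) blast
  moreover have "(y - y0) + (G d - ?h) = G (v + d)" by (simp add: blinfun.bilinear_simps)
  ultimately have 1: "G (v + d) \<in> tangent_cone K y0"
    using closure_radial_cone_subset_tangent_cone[OF K y0] by auto
  have yy: "norm (y - y0) \<le> (norm G + 2) * ?t"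
  proof -
    have "2 * e * ?t \<le> 2 * ?t" using e by (simp add: mult_right_mono)
    then show ?thesis
      using norm_triangle_sub[of "y - y0" "G v"] norm_blinfun[of G v] lin
      by (simp add: algebra_simps)
  qed
  have f: "f u = - (G u \<bullet> l0)" for u
    using l0(2) by (metis add_eq_0_iff blinfun.minus_left dual_adjoint_apply minus_minus)
  have "f v = (m - l0) \<bullet> (y - y0) + m \<bullet> (y0 - y) + l0 \<bullet> ?h"
    unfolding f by (simp add: algebra_simps inner_commute)
  moreover have "m \<bullet> (y0 - y) \<le> 0" using m y0 by (simp add: normal_cone_def)
  moreover have "(m - l0) \<bullet> (y - y0) \<le> C * (norm G + 2) * e * ?t"
  proof -
    have C0: "0 \<le> C * ?t" using mult norm_ge_zero order_trans by blast
    have "(m - l0) \<bullet> (y - y0) \<le> norm (m - l0) * norm (y - y0)" by (rule norm_cauchy_schwarz)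
    also have "\<dots> \<le> (C * ?t) * ((norm G + 2) * ?t)" using mult yy C0 by (intro mult_mono) auto
    also have "\<dots> \<le> (C * ?t) * ((norm G + 2) * e)"
      using e C0 by (intro mult_left_mono) auto
    finally show ?thesis by (simp add: ac_simps)
  qed
  moreover have "l0 \<bullet> ?h \<le> 2 * norm l0 * e * ?t"
  proof -
    have "l0 \<bullet> ?h \<le> norm l0 * norm ?h" by (rule norm_cauchy_schwarz)
    also have "\<dots> \<le> norm l0 * (2 * e * ?t)" using lin by (intro mult_left_mono) auto
    finally show ?thesis by (simp add: ac_simps)
  qed
  moreover have "f d \<le> norm f * (4 / r) * e * ?t"
  proof -
    have "f d \<le> norm f * norm d" using norm_blinfun[of f d] by simp
    also have "\<dots> \<le> norm f * (4 / r * e * ?t)" using nd by (intro mult_left_mono) auto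
    finally show ?thesis by (simp add: ac_simps)
  qed
  ultimately have "f (v + d) \<le> (C * (norm G + 2) + 2 * norm l0 + norm f * (4 / r)) * e * ?t"
    by (simp add: blinfun.add_right algebra_simps)
  with 1 nd show ?thesis by blast
qed

text \<open>The vector \<open>v\<close> is the displacement of \<open>x\<close> from the reference point with value \<open>y0\<close> and multiplier \<open>l0\<close>.
  Testing \<open>lagrange F g x l\<close> with \<open>v\<close> gives \<open>Q v v\<close> plus \<open>(\<mu> - l0) \<bullet> (y - y0)\<close> plus
  errors of order \<open>e \<parallel>v\<parallel>\<^sup>2\<close>, where \<open>\<mu> = l + g x - y\<close>. The inner product is nonnegative by the monotonicity
  of the normal cone, so it can be dropped from an upper bound for \<open>Q v v\<close>.\<close>

lemma curvature_upper_bound: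
  fixes F :: "'a::real_normed_vector \<Rightarrow> ('a \<Rightarrow>\<^sub>L real)" and g :: "'a \<Rightarrow> 'h::real_inner"
    and Q :: "'a \<Rightarrow>\<^sub>L ('a \<Rightarrow>\<^sub>L real)" and G :: "'a \<Rightarrow>\<^sub>L 'h"
  assumes e: "0 \<le> e" "e \<le> 1" "norm v \<le> e" and pos: "0 \<le> L" "0 \<le> C"
    and linL: "norm (lagrange F g x l0 - Q v) \<le> e * norm v"
    and res: "norm (lagrange F g x l) \<le> e * norm v" "norm (g x - y) \<le> e * norm v"
    and lin: "norm (y - y0 - G v) \<le> 2 * e * norm v"
    and Dg: "norm (fderiv g x - G) \<le> L * norm v"
    and mult: "norm (l + g x - y - l0) \<le> C * norm v"
    and mono: "0 \<le> (l + g x - y - l0) \<bullet> (y - y0)"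
  shows "Q v v \<le> (2 + 2 * C + C * L + norm G + L) * e * (norm v)\<^sup>2"
proof -
  let ?t = "norm v" and ?m = "l + g x - y" and ?Gx = "fderiv g x"
  have app: "T v \<le> k * ?t" if "norm T \<le> k" for T :: "'a \<Rightarrow>\<^sub>L real" and k
    using norm_blinfun[of T v] mult_right_mono[OF that norm_ge_zero[of v]] by simp
  have "Q v v = (Q v - lagrange F g x l0) v + lagrange F g x l v
      - (?m - l0) \<bullet> (y - y0) + (?m - l0) \<bullet> (y - y0 - G v)
      - (?m - l0) \<bullet> (?Gx - G) v + (g x - y) \<bullet> ?Gx v"
    by (simp add: lagrange_def blinfun.bilinear_simps algebra_simps inner_commute)
  moreover have "(Q v - lagrange F g x l0) v \<le> e * ?t * ?t"
    using linL by (intro app) (simp add: norm_minus_commute)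
  moreover have "lagrange F g x l v \<le> e * ?t * ?t" using res(1) by (rule app)
  moreover have "(?m - l0) \<bullet> (y - y0 - G v) \<le> 2 * C * e * ?t * ?t"
  proof -
    have "(?m - l0) \<bullet> (y - y0 - G v) \<le> norm (?m - l0) * norm (y - y0 - G v)"
      by (rule norm_cauchy_schwarz)
    also have "\<dots> \<le> (C * ?t) * (2 * e * ?t)" using mult lin pos by (intro mult_mono) auto
    finally show ?thesis by (simp add: ac_simps)
  qed
  moreover have "- ((?m - l0) \<bullet> (?Gx - G) v) \<le> C * L * e * ?t * ?t"
  proof -
    have "norm ((?Gx - G) v) \<le> L * ?t * ?t"
      using norm_blinfun[of "?Gx - G" v] mult_right_mono[OF Dg norm_ge_zero[of v]] by linarith
    also have "\<dots> \<le> L * e * ?t" using e pos by (intro mult_right_mono mult_left_mono) auto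
    finally have 1: "norm ((?Gx - G) v) \<le> L * e * ?t" .
    have "- ((?m - l0) \<bullet> (?Gx - G) v) \<le> norm (?m - l0) * norm ((?Gx - G) v)"
      using Cauchy_Schwarz_ineq2[of "?m - l0" "(?Gx - G) v"] by linarith
    also have "\<dots> \<le> (C * ?t) * (L * e * ?t)" using mult 1 pos by (intro mult_mono) auto
    finally show ?thesis by (simp add: ac_simps)
  qed
  moreover have "(g x - y) \<bullet> ?Gx v \<le> (norm G + L) * e * ?t * ?t"
  proof -
    have "L * ?t \<le> L" using e pos by (intro mult_left_le) auto
    then have "norm ?Gx \<le> norm G + L" using norm_triangle_sub[of ?Gx G] Dg by linarith
    then have 1: "norm (?Gx v) \<le> (norm G + L) * ?t"
      using norm_blinfun[of ?Gx v] mult_right_mono[OF _ norm_ge_zero[of v]] order_trans by blast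
    have "(g x - y) \<bullet> ?Gx v \<le> norm (g x - y) * norm (?Gx v)" by (rule norm_cauchy_schwarz)
    also have "\<dots> \<le> (e * ?t) * ((norm G + L) * ?t)" using res(2) 1 e by (intro mult_mono) auto
    finally show ?thesis by (simp add: ac_simps)
  qed
  ultimately show ?thesis using mono by (simp add: algebra_simps power2_eq_square)
qed

text \<open>If the residual \<open>s\<close> is smaller than \<open>e \<parallel>x - xbar\<parallel>\<close>, then \<open>x - xbar\<close> is, up to a relative error of order \<open>e\<close>, a
  direction of the enlarged critical cone. There the second-order condition bounds the curvature
  below by a fixed multiple of \<open>\<parallel>x - xbar\<parallel>\<^sup>2\<close>, whereas the curvature is at most of order \<open>e \<parallel>x - xbar\<parallel>\<^sup>2\<close>.
  For small \<open>e\<close> this is impossible, so \<open>\<parallel>x - xbar\<parallel> \<le> s / e\<close>.\<close>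

lemma primal_error_bound:
  fixes F :: "'a::banach \<Rightarrow> ('a \<Rightarrow>\<^sub>L real)" and g :: "'a \<Rightarrow> 'h::real_inner"
  assumes K: "convex K"
    and r: "r > 0" "cball 0 r \<subseteq> closure (robinson_set (fderiv g xbar) K (g xbar) lbar)"
    and KKT: "KKT_point F g K xbar lbar"
    and SOSC: "SOSC F g K xbar lbar"
    and F: "F differentiable (at xbar)" and g: "g differentiable (at xbar)"
    and Dg: "fderiv g differentiable (at xbar)"
    and C: "C > 0" "\<delta>1 > 0"
    and mult: "\<And>x l y s. norm (x - xbar) < \<delta>1 \<Longrightarrow> s < \<delta>1 \<Longrightarrow>
      norm (lagrange F g x l) + norm (g x - y) = s \<Longrightarrow> l + g x - y \<in> normal_cone K y \<Longrightarrow>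
      norm (l + g x - y - lbar) \<le> C * (norm (x - xbar) + s)"
  shows "\<exists>M>0. \<exists>\<delta>>0. \<forall>x l y s. norm (x - xbar) < \<delta> \<longrightarrow> s < \<delta> \<longrightarrow>
    norm (lagrange F g x l) + norm (g x - y) = s \<longrightarrow> l + g x - y \<in> normal_cone K y \<longrightarrow>
    norm (x - xbar) \<le> M * s"
proof -
  let ?G = "fderiv g xbar"
  define Q where "Q = fderiv (\<lambda>z. lagrange F g z lbar) xbar"
  have lb: "lbar \<in> normal_cone K (g xbar)" "F xbar + dual_adjoint ?G lbar = 0"
    and L0: "lagrange F g xbar lbar = 0"
    using KKT by (auto simp: KKT_point_def lagrange_def)
  obtain \<eta> c where \<eta>: "\<eta> > 0" "c > 0"
    "\<And>d. F xbar d \<le> \<eta> * norm d \<Longrightarrow> ?G d \<in> tangent_cone K (g xbar) \<Longrightarrow> c * (norm d)\<^sup>2 \<le> Q d d"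
    using SOSC unfolding SOSC_def critical_cone_def Q_def by blast
  obtain L \<delta>2 where L: "L > 0" "\<delta>2 > 0"
    "\<And>x. norm (x - xbar) < \<delta>2 \<Longrightarrow> norm (fderiv g x - ?G) \<le> L * norm (x - xbar)"
    using differentiable_imp_pointwise_Lipschitz[OF Dg] by blast
  define \<kappa> where "\<kappa> = 4 / r"
  define A where "A = 2 * C * (norm ?G + 2) + 2 * norm lbar + norm (F xbar) * \<kappa>"
  define B where "B = 2 + 2 * (2 * C) + 2 * C * L + norm ?G + L + 3 * norm Q * \<kappa>"
  have \<kappa>: "\<kappa> > 0" using r by (simp add: \<kappa>_def)
  have A: "A > 0" unfolding A_def using C \<kappa>
    by (intro add_pos_nonneg mult_pos_pos add_nonneg_pos mult_nonneg_nonneg) auto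
  have "0 \<le> 2 * C * L" "0 \<le> norm Q * \<kappa>" using C L \<kappa> by (auto intro!: mult_nonneg_nonneg)
  then have B: "B > 0" unfolding B_def using C L(1) norm_ge_zero[of ?G] by linarith
  note pos = \<kappa> A B
  \<comment> \<open>These bounds ensure, in order, that the corrected direction keeps at least half of
    its length, that it lies in the enlarged critical cone, and that the curvature bounds clash.\<close>
  define e where "e = min (min 1 (1 / (2 * \<kappa>))) (min (\<eta> / (2 * A)) (c / (8 * B)))"
  have e: "e > 0" "e \<le> 1" "e \<le> 1 / (2 * \<kappa>)" "e \<le> \<eta> / (2 * A)" "e \<le> c / (8 * B)"
    using pos \<eta> by (auto simp: e_def)
  have e': "\<kappa> * e \<le> 1 / 2" "A * e \<le> \<eta> / 2" "B * e \<le> c / 8"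
    using e(3,4,5) pos by (simp_all add: field_simps)
  obtain \<delta>3 where \<delta>3: "\<delta>3 > 0" "\<And>x. norm (x - xbar) < \<delta>3 \<Longrightarrow>
      norm (g x - g xbar - ?G (x - xbar)) \<le> e * norm (x - xbar)"
    using linearization_error[OF g e(1)] by blast
  obtain \<delta>4 where \<delta>4: "\<delta>4 > 0" "\<And>x. norm (x - xbar) < \<delta>4 \<Longrightarrow>
      norm (lagrange F g x lbar - lagrange F g xbar lbar - Q (x - xbar)) \<le> e * norm (x - xbar)"
    using linearization_error[OF lagrange_differentiable[OF F Dg] e(1), of lbar]
    unfolding Q_def by blast
  define \<delta> where "\<delta> = min (min e \<delta>1) (min \<delta>2 (min \<delta>3 \<delta>4))"
  have \<delta>: "\<delta> > 0" "\<delta> \<le> e" "\<delta> \<le> \<delta>1" "\<delta> \<le> \<delta>2" "\<delta> \<le> \<delta>3" "\<delta> \<le> \<delta>4"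
    using e C L \<delta>3 \<delta>4 by (auto simp: \<delta>_def)
  have "norm (x - xbar) \<le> 1 / e * s"
    if x: "norm (x - xbar) < \<delta>" and s: "s < \<delta>"
      "norm (lagrange F g x l) + norm (g x - y) = s" and m: "l + g x - y \<in> normal_cone K y"
    for x l y s
  proof (rule ccontr)
    assume "\<not> ?thesis"
    define v where "v = x - xbar"
    let ?t = "norm v"
    have small: "s < e * ?t" using \<open>\<not> _\<close> e(1) by (simp add: v_def field_simps)
    have res: "norm (lagrange F g x l) \<le> e * ?t" "norm (g x - y) \<le> e * ?t"
      using small s(2) norm_ge_zero[of "g x - y"] norm_ge_zero[of "lagrange F g x l"] by linarith+
    have t0: "?t > 0"
      using small s(2) e(1) norm_ge_zero[of "g x - y"] norm_ge_zero[of "lagrange F g x l"]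
      by (smt (verit) mult_nonneg_nonpos)
    have te: "?t \<le> e" using x \<delta> by (simp add: v_def)
    have "s \<le> ?t" using small mult_right_mono[OF e(2) norm_ge_zero[of v]] by linarith
    then have "C * (?t + s) \<le> C * (?t + ?t)" using C(1) by (intro mult_left_mono) auto
    moreover have "norm (l + g x - y - lbar) \<le> C * (?t + s)"
      unfolding v_def using x s(1) \<delta>(3) by (intro mult[OF _ _ s(2) m]) auto
    ultimately have mt: "norm (l + g x - y - lbar) \<le> 2 * C * ?t" by simp
    have lin: "norm (y - g xbar - ?G v) \<le> 2 * e * ?t"
    proof -
      have "y - g xbar - ?G v = (g x - g xbar - ?G v) - (g x - y)" by simp
      then have "norm (y - g xbar - ?G v) \<le> norm (g x - g xbar - ?G v) + norm (g x - y)"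
        by (simp only: norm_triangle_ineq4)
      then show ?thesis using \<delta>3(2)[of x] x \<delta> res(2) by (simp add: v_def)
    qed
    have linL: "norm (lagrange F g x lbar - Q v) \<le> e * ?t"
      using \<delta>4(2)[of x] x \<delta> L0 by (simp add: v_def)
    have Dgx: "norm (fderiv g x - ?G) \<le> L * ?t" using L(3)[of x] x \<delta> by (simp add: v_def)
    \<comment> \<open>Monotonicity of the normal cone mapping.\<close>
    have mono: "0 \<le> (l + g x - y - lbar) \<bullet> (y - g xbar)"
    proof -
      have "(l + g x - y) \<bullet> (g xbar - y) \<le> 0" "lbar \<bullet> (y - g xbar) \<le> 0"
        using m lb(1) by (simp_all add: normal_cone_def)
      then show ?thesis by (simp add: inner_simps)
    qed
    obtain d where d: "norm d \<le> \<kappa> * e * ?t" "?G (v + d) \<in> tangent_cone K (g xbar)"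
      "F xbar (v + d) \<le> A * e * ?t"
      using nearby_critical_direction[OF K r lb m less_imp_le[OF e(1)] e(2) te lin mt]
      unfolding A_def \<kappa>_def by blast
    have d2: "norm d \<le> ?t / 2"
      using d(1) mult_right_mono[OF e'(1) norm_ge_zero[of v]] by linarith
    have w1: "?t / 2 \<le> norm (v + d)" using norm_diff_ineq[of v d] d2 by linarith
    have w2: "norm (v + d) \<le> 2 * ?t" using norm_triangle_ineq[of v d] d2 t0 by linarith
    have "A * e * ?t \<le> \<eta> / 2 * ?t" using e'(2) by (intro mult_right_mono) auto
    also have "\<dots> \<le> \<eta> * norm (v + d)" using mult_left_mono[OF w1, of \<eta>] \<eta>(1) by simp
    finally have "F xbar (v + d) \<le> \<eta> * norm (v + d)" using d(3) by linarith
    then have "c * (norm (v + d))\<^sup>2 \<le> Q (v + d) (v + d)" using d(2) \<eta>(3) by blast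
    moreover have "c * (?t / 2)\<^sup>2 \<le> c * (norm (v + d))\<^sup>2"
      using w1 t0 \<eta>(2) by (intro mult_left_mono power_mono) auto
    ultimately have lower: "c / 4 * ?t\<^sup>2 \<le> Q (v + d) (v + d)" by (simp add: power_divide)
    have Qb: "Q a b \<le> norm Q * norm a * norm b" for a b
    proof -
      have "Q a b \<le> norm (Q a) * norm b" using norm_blinfun[of "Q a" b] by simp
      also have "\<dots> \<le> norm Q * norm a * norm b" by (intro mult_right_mono norm_blinfun) auto
      finally show ?thesis .
    qed
    have "Q (v + d) (v + d) = Q v v + Q v d + Q d (v + d)"
      by (simp add: blinfun.bilinear_simps)
    moreover have "Q v d \<le> norm Q * \<kappa> * e * ?t\<^sup>2"
    proof -
      have "norm Q * ?t * norm d \<le> norm Q * ?t * (\<kappa> * e * ?t)"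
        using d(1) by (intro mult_left_mono) auto
      then show ?thesis using Qb[of v d] by (simp add: power2_eq_square ac_simps)
    qed
    moreover have "Q d (v + d) \<le> 2 * norm Q * \<kappa> * e * ?t\<^sup>2"
    proof -
      have "norm Q * norm d * norm (v + d) \<le> norm Q * (\<kappa> * e * ?t) * (2 * ?t)"
        using d(1) w2 pos e(1) by (intro mult_mono) auto
      then show ?thesis using Qb[of d "v + d"] by (simp add: power2_eq_square ac_simps)
    qed
    moreover have "Q v v \<le> (2 + 2 * (2 * C) + 2 * C * L + norm ?G + L) * e * ?t\<^sup>2"
      using curvature_upper_bound[OF less_imp_le[OF e(1)] e(2) te _ _ linL res lin Dgx mt mono]
        L(1) C(1) by simp
    ultimately have "Q (v + d) (v + d) \<le> B * e * ?t\<^sup>2"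
      by (simp add: B_def algebra_simps)
    also have "\<dots> \<le> c / 8 * ?t\<^sup>2" using e'(3) by (intro mult_right_mono) auto
    also have "\<dots> < c / 4 * ?t\<^sup>2" using t0 \<eta>(2) by simp
    finally show False using lower by simp
  qed
  note bound = this
  have "1 / e > 0" using e(1) by simp
  then show ?thesis
    using \<delta>(1) by (intro exI[of _ "1 / e"] exI[of _ \<delta>] conjI allI impI bound)
qed

section \<open>The primal-dual error bound\<close>

theorem theorem3p2:
  fixes F :: "'a::banach \<Rightarrow> ('a \<Rightarrow>\<^sub>L real)"
    and g :: "'a \<Rightarrow> 'h::{real_inner, banach}"
    and K :: "'h set" and xbar :: 'a and lbar :: 'h
  assumes "K \<noteq> {}" and "closed K" and "convex K"
    and "continuously_differentiable F"
    and "twice_continuously_differentiable g"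
    and "KKT_point F g K xbar lbar"
    and "SOSC F g K xbar lbar"
    and "strict_Robinson g K xbar lbar"
  shows "multiplier_set F g K xbar = {lbar} \<and>
    (\<exists>c>0. \<exists>\<delta>>0. \<forall>x l. norm (x - xbar) < \<delta> \<and> residual F g K x l < \<delta> \<longrightarrow>
      norm (x - xbar) + norm (l - lbar) \<le> c * residual F g K x l)"
proof
  let ?G = "fderiv g xbar"
  have lb: "lbar \<in> normal_cone K (g xbar)" "F xbar + dual_adjoint ?G lbar = 0"
    using assms(6) by (auto simp: KKT_point_def lagrange_def)
  have F: "F differentiable (at xbar)" and g: "g differentiable (at xbar)"
    and Dg: "fderiv g differentiable (at xbar)"
    using assms(4,5)
    by (auto simp: continuously_differentiable_def twice_continuously_differentiable_def)
  obtain r where r: "r > 0" "cball 0 r \<subseteq> closure (robinson_set ?G K (g xbar) lbar)"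
    using strict_Robinson_imp_cball[OF assms(3) _ assms(8)] lb(1) by (auto simp: normal_cone_def)
  have "l = lbar" if "l \<in> multiplier_set F g K xbar" for l
  proof -
    have l: "l \<in> normal_cone K (g xbar)" "F xbar + dual_adjoint ?G l = 0"
      using that by (auto simp: multiplier_set_def KKT_point_def lagrange_def)
    have "dual_adjoint ?G (l - lbar) = 0"
      using l(2) lb(2) by (metis add_left_cancel dual_adjoint_diff right_minus_eq)
    then have "r * norm (l - lbar) \<le> 0"
      using multiplier_difference_bound[OF r lb(1) l(1)] by simp
    then show ?thesis using r(1) by (simp add: mult_le_0_iff)
  qed
  moreover have "lbar \<in> multiplier_set F g K xbar"
    using assms(6) by (simp add: multiplier_set_def)
  ultimately show "multiplier_set F g K xbar = {lbar}" by blast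
  obtain C \<delta>1 where C: "C > 0" "\<delta>1 > 0"
    "\<And>x l y s. norm (x - xbar) < \<delta>1 \<Longrightarrow> s < \<delta>1 \<Longrightarrow>
      norm (lagrange F g x l) + norm (g x - y) = s \<Longrightarrow> l + g x - y \<in> normal_cone K y \<Longrightarrow>
      norm (l + g x - y - lbar) \<le> C * (norm (x - xbar) + s)"
    using multiplier_error_bound[OF r assms(6) F g Dg] by blast
  obtain M \<delta>2 where M: "M > 0" "\<delta>2 > 0"
    "\<And>x l y s. norm (x - xbar) < \<delta>2 \<Longrightarrow> s < \<delta>2 \<Longrightarrow>
      norm (lagrange F g x l) + norm (g x - y) = s \<Longrightarrow> l + g x - y \<in> normal_cone K y \<Longrightarrow>
      norm (x - xbar) \<le> M * s"
    using primal_error_bound[OF assms(3) r assms(6,7) F g Dg C] by blast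
  have bound: "norm (x - xbar) + norm (l - lbar) \<le> (M + C * (M + 1) + 1) * residual F g K x l"
    if x: "norm (x - xbar) < min \<delta>1 \<delta>2" and s: "residual F g K x l < min \<delta>1 \<delta>2" for x l
  proof -
    define y where "y = metric_projection K (g x + l)"
    let ?s = "residual F g K x l"
    have m: "l + g x - y \<in> normal_cone K y"
      using metric_projection_normal[OF assms(1-3), of "g x + l"] by (simp add: y_def add.commute)
    have res: "norm (lagrange F g x l) + norm (g x - y) = ?s"
      by (simp add: residual_def y_def)
    have a: "norm (x - xbar) \<le> M * ?s" using M(3)[OF _ _ res m] x s by simp
    have "norm (l + g x - y - lbar) \<le> C * (norm (x - xbar) + ?s)"
      using C(3)[OF _ _ res m] x s by simp
    also have "\<dots> \<le> C * (M * ?s + ?s)" using a C(1) by (intro mult_left_mono) auto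
    finally have b: "norm (l + g x - y - lbar) \<le> C * (M + 1) * ?s" by (simp add: algebra_simps)
    have "l - lbar = (l + g x - y - lbar) - (g x - y)" by simp
    then have "norm (l - lbar) \<le> norm (l + g x - y - lbar) + norm (g x - y)"
      by (simp only: norm_triangle_ineq4)
    moreover have "norm (g x - y) \<le> ?s" using res norm_ge_zero[of "lagrange F g x l"] by linarith
    ultimately show ?thesis using a b by (simp add: algebra_simps)
  qed
  have "min \<delta>1 \<delta>2 > 0" using C(2) M(2) by simp
  moreover have "M + C * (M + 1) + 1 > 0" using M C by (intro add_pos_pos mult_pos_pos) auto
  ultimately show "\<exists>c>0. \<exists>\<delta>>0. \<forall>x l. norm (x - xbar) < \<delta> \<and> residual F g K x l < \<delta> \<longrightarrow>
      norm (x - xbar) + norm (l - lbar) \<le> c * residual F g K x l"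
    by (intro exI[of _ "M + C * (M + 1) + 1"] exI[of _ "min \<delta>1 \<delta>2"] conjI allI impI bound) auto
qed

end
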